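(* Let $n\ge 0$, $k\in\mathbb{Z}$, $s\in\mathbb{Z}_{\ge0}$, $\lambda\in\mathbb{C}$ with $\lambda\neq1$, and $a\in\mathbb{C}$ with $a\neq0$. Then \[ PC_{n}^{(k)}(x:a)=\frac{1}{(1-\lambda)^{s}}\sum_{m=0}^{n}\left\{(-1)^{m}\sum_{l=0}^{n-m}\sum_{i=0}^{s}\frac{\binom{n}{l}\binom{s}{i}(l)_{i}}{a^{n-l+i}}(1-\lambda)^{s-i}(-\lambda)^{i}S_{1}(n-l,m)\,PC_{l-i}^{(k)}(s:a)\right\}H_{m}^{(s)}(x\mid\lambda), \] where terms with $i>l$ are zero (since $(l)_i=0$ there).
   Context: For an integer $k$, $\mathrm{Lif}_k(t)=\sum_{n=0}^{\infty}\frac{t^{n}}{n!\,(n+1)^{k}}$. For $a\neq0$, $PC_n^{(k)}(x:a)$ is defined by $e^{-t}\,\mathrm{Lif}_k\!\left(\log\left(1+\frac{t}{a}\right)\right)\left(1+\frac{t}{a}\right)^{-x}=\sum_{n\ge0}PC_n^{(k)}(x:a)\frac{t^n}{n!}$. $(l)_i=l(l-1)\cdots(l-i+1)$ is the falling factorial. $S_1(n,l)$ denotes the (signed) Stirling numbers of the first kind, defined by $(x)_n=\sum_{l=0}^{n}S_1(n,l)x^l$. The Frobenius-Euler polynomials of order $s$ are defined by $\left(\frac{1-\lambda}{e^t-\lambda}\right)^{s}e^{xt}=\sum_{n\ge0}H_n^{(s)}(x\mid\lambda)\frac{t^n}{n!}$. *)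

theory Defs
  imports Complex_Main "HOL-Computational_Algebra.Computational_Algebra"
begin

definition falling_factorial :: "'a::comm_ring_1 \<Rightarrow> nat \<Rightarrow> 'a" where
  "falling_factorial x n = (\<Prod>j<n. x - of_nat j)"

text \<open>Signed Stirling numbers of the first kind: the coefficients of \<open>(x)\<^sub>n\<close>,
  taken in the polynomial ring, where \<open>[:0, 1:]\<close> is the indeterminate.\<close>

definition stirling1 :: "nat \<Rightarrow> nat \<Rightarrow> int" where
  "stirling1 n l = coeff (falling_factorial [:0, 1:] n) l"

definition Lif :: "int \<Rightarrow> complex fps" where
  "Lif k = Abs_fps (\<lambda>n. 1 / (fact n * of_nat (n + 1) powi k))"

text \<open>The series \<open>fps_ln 1\<close> is \<open>log (1 + t)\<close> and \<open>fps_binomial c\<close> is \<open>(1 + t)\<^sup>c\<close>.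
  All compositions are with series without constant term.\<close>

definition PC_egf :: "int \<Rightarrow> complex \<Rightarrow> complex \<Rightarrow> complex fps" where
  "PC_egf k x a =
     fps_exp (-1) * (Lif k oo (fps_ln 1 oo (fps_const (1 / a) * fps_X)))
       * (fps_binomial (-x) oo (fps_const (1 / a) * fps_X))"

definition PC :: "nat \<Rightarrow> int \<Rightarrow> complex \<Rightarrow> complex \<Rightarrow> complex" where
  "PC n k x a = fact n * fps_nth (PC_egf k x a) n"

text \<open>For \<open>lam \<noteq> 1\<close> the divisor has constant term \<open>1 - lam \<noteq> 0\<close>, so it is a unit.\<close>

definition frobenius_euler_egf :: "nat \<Rightarrow> complex \<Rightarrow> complex \<Rightarrow> complex fps" where
  "frobenius_euler_egf s x lam =
     (fps_const (1 - lam) / (fps_exp 1 - fps_const lam)) ^ s * fps_exp x"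

definition frobenius_euler :: "nat \<Rightarrow> nat \<Rightarrow> complex \<Rightarrow> complex \<Rightarrow> complex" where
  "frobenius_euler m s x lam = fact m * fps_nth (frobenius_euler_egf s x lam) m"

end

theory Submission
  imports Defs
begin

text \<open>
  Put \<open>u = 1 + t/a\<close>. Substituting \<open>-log u\<close> for the variable of the Frobenius-Euler generating
  function turns it into \<open>((1 - lam) / (u\<^sup>-\<^sup>1 - lam))\<^sup>s u\<^sup>-\<^sup>x\<close>. Since
  \<open>(u\<^sup>-\<^sup>1 - lam)\<^sup>s = u\<^sup>-\<^sup>s (1 - lam - lam t/a)\<^sup>s\<close>, the generating function of \<open>PC\<close> at \<open>x\<close>, multiplied by
  \<open>(1 - lam)\<^sup>s\<close>, is the one at \<open>s\<close> times the polynomial \<open>(1 - lam - lam t/a)\<^sup>s\<close> times this substituted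
  series. The theorem compares coefficients, where \<open>(log u)\<^sup>m / m!\<close> is the exponential generating
  function of the Stirling numbers \<open>S\<^sub>1(j, m)\<close> scaled by \<open>a\<^sup>-\<^sup>j\<close>.
\<close>

lemma falling_factorial_Suc:
  "falling_factorial x (Suc n) = falling_factorial x n * (x - of_nat n)"
  by (simp add: falling_factorial_def)

lemma falling_factorial_eq_gbinomial:
  fixes x :: "'a::field_char_0"
  shows "falling_factorial x n = fact n * (x gchoose n)"
  by (simp add: falling_factorial_def gbinomial_prod_rev atLeast0LessThan)

lemma falling_factorial_of_nat:
  "falling_factorial (of_nat l :: 'a::field_char_0) i =
     (if i \<le> l then fact l / fact (l - i) else 0)"
  by (auto simp: falling_factorial_eq_gbinomial binomial_fact simp flip: binomial_gbinomial)

lemma poly_falling_factorial: "poly (falling_factorial p n) x = falling_factorial (poly p x) n"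
  by (simp add: falling_factorial_def poly_prod)

lemma coeff_falling_factorial_Suc:
  "coeff (falling_factorial [:0, 1:] (Suc n) :: 'a::comm_ring_1 poly) l =
     (case l of 0 \<Rightarrow> 0 | Suc l' \<Rightarrow> coeff (falling_factorial [:0, 1:] n) l')
       - of_nat n * coeff (falling_factorial [:0, 1:] n) l"
  by (simp add: falling_factorial_Suc of_nat_poly coeff_pCons split: nat.split)

text \<open>Both sides satisfy the same recurrence in \<open>n\<close>, so the integer Stirling
  numbers serve as coefficients over every commutative ring.\<close>

lemma coeff_falling_factorial:
  "coeff (falling_factorial [:0, 1:] n :: 'a::comm_ring_1 poly) l = of_int (stirling1 n l)"
proof (induction n arbitrary: l)
  case 0
  show ?case by (simp add: stirling1_def falling_factorial_def coeff_1)
next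
  case (Suc n)
  then show ?case
    unfolding stirling1_def coeff_falling_factorial_Suc by (simp split: nat.split)
qed

text \<open>Both series have constant term 1 and solve \<open>(1 + t) f' = c f\<close>, which
  determines \<open>f\<close>.\<close>

lemma fps_exp_compose_fps_ln:
  "fps_exp c oo fps_ln 1 = (fps_binomial c :: 'a::field_char_0 fps)"
proof -
  have "fps_deriv (fps_exp c oo fps_ln 1) = fps_const c * (fps_exp c oo fps_ln 1) / (1 + fps_X)"
    by (simp add: fps_compose_deriv fps_ln_deriv fps_compose_mult_distrib fps_divide_unit)
  then show ?thesis
    by (simp flip: fps_binomial_ODE_unique')
qed

text \<open>The coefficient of \<open>t^j\<close> in \<open>(1 + t)^x = exp (x log (1 + t))\<close>
  is a polynomial in \<open>x\<close>. Expanding the exponential and expanding the binomial series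
  give two forms of it, whose coefficients are compared.\<close>

lemma fps_ln_power_nth:
  "fps_nth (fps_ln 1 ^ m :: 'a::field_char_0 fps) j = fact m / fact j * of_int (stirling1 j m)"
proof -
  \<comment> \<open>Stopping at \<open>j\<close> loses nothing: \<open>log (1 + t)^i\<close> starts
    at degree \<open>i\<close>.\<close>
  define p :: "'a poly" where "p = (\<Sum>i\<le>j. monom (fps_nth (fps_ln 1 ^ i) j / fact i) i)"
  have "poly p x = poly (smult (1 / fact j) (falling_factorial [:0, 1:] j)) x" for x
  proof -
    have "poly p x = fps_nth (fps_exp x oo fps_ln 1) j"
      by (simp add: p_def poly_sum poly_monom fps_compose_nth atLeast0AtMost mult.commute)
    then show ?thesis
      by (simp add: fps_exp_compose_fps_ln poly_falling_factorial falling_factorial_eq_gbinomial)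
  qed
  then have "p = smult (1 / fact j) (falling_factorial [:0, 1:] j)"
    by (simp add: poly_eq_poly_eq_iff[symmetric] fun_eq_iff)
  then have "coeff p m = of_int (stirling1 j m) / fact j"
    by (simp add: coeff_falling_factorial)
  moreover have "coeff p m = fps_nth (fps_ln 1 ^ m) j / fact m"
  proof (cases "m \<le> j")
    case True
    then show ?thesis by (simp add: p_def coeff_sum)
  next
    case False
    then have "fps_nth (fps_ln 1 ^ m :: 'a fps) j = 0"
      by (intro startsby_zero_power_prefix[rule_format]) auto
    with False show ?thesis by (simp add: p_def coeff_sum)
  qed
  ultimately show ?thesis by (simp add: field_simps)
qed

lemma stirling1_eq_0: "j < m \<Longrightarrow> stirling1 j m = 0"
proof -
  assume "j < m"
  then have "fps_nth (fps_ln 1 ^ m :: complex fps) j = 0"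
    by (intro startsby_zero_power_prefix[rule_format]) auto
  then show ?thesis by (simp add: fps_ln_power_nth)
qed

text \<open>As \<open>h ^ m\<close> has no terms below degree \<open>m\<close>, the composition sums
  at all indices up to \<open>n\<close> can share the bound \<open>n\<close>, and then the two sums
  can be swapped.\<close>

lemma fps_mult_compose_nth:
  fixes f g h :: "'a::comm_ring_1 fps"
  assumes "fps_nth h 0 = 0"
  shows "fps_nth (f * (g oo h)) n = (\<Sum>m=0..n. fps_nth g m * fps_nth (f * h ^ m) n)"
proof -
  have compose: "fps_nth (g oo h) i = (\<Sum>m=0..n. fps_nth g m * fps_nth (h ^ m) i)" if "i \<le> n" for i
    unfolding fps_compose_nth using that startsby_zero_power_prefix[OF assms]
    by (intro sum.mono_neutral_left) auto
  have "fps_nth (f * (g oo h)) n =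
      (\<Sum>i=0..n. \<Sum>m=0..n. fps_nth f i * (fps_nth g m * fps_nth (h ^ m) (n - i)))"
    by (simp add: fps_mult_nth compose sum_distrib_left)
  also have "\<dots> = (\<Sum>m=0..n. fps_nth g m * fps_nth (f * h ^ m) n)"
    by (subst sum.swap) (simp add: fps_mult_nth sum_distrib_left mult_ac)
  finally show ?thesis .
qed

lemma fps_uminus_power:
  fixes g :: "'a::comm_ring_1 fps"
  shows "(- g) ^ m = fps_const ((- 1) ^ m) * g ^ m"
  by (induction m) (simp_all add: mult_ac flip: fps_const_neg fps_const_mult)

lemma fps_exp_compose_uminus:
  "fps_exp c oo (- g) = (fps_exp (- c) oo g :: 'a::field_char_0 fps)"
  by (rule fps_ext) (simp add: fps_compose_nth fps_uminus_power power_minus[of c] mult_ac)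

text \<open>Clearing the denominator lets the later substitution go through products and powers
  only, with no quotient to compose.\<close>

lemma frobenius_euler_egf_mult:
  assumes "lam \<noteq> 1"
  shows "frobenius_euler_egf s x lam * (fps_exp 1 - fps_const lam) ^ s =
    fps_const ((1 - lam) ^ s) * fps_exp x"
proof -
  have unit: "fps_nth (fps_exp 1 - fps_const lam) 0 \<noteq> 0"
    using assms by simp
  then have "fps_const (1 - lam) / (fps_exp 1 - fps_const lam) * (fps_exp 1 - fps_const lam)
      = fps_const (1 - lam)"
    by (simp add: fps_divide_unit mult.assoc inverse_mult_eq_1)
  then show ?thesis
    unfolding frobenius_euler_egf_def
    by (metis (no_types, lifting) fps_const_power mult.assoc mult.commute power_mult_distrib)
qed

lemma PC_egf_conv_frobenius_euler_egf:
  fixes a :: complex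
  assumes "lam \<noteq> 1"
  defines "v \<equiv> fps_const (1 / a) * fps_X"
  shows "fps_const ((1 - lam) ^ s) * PC_egf k x a =
    PC_egf k (of_nat s) a * (fps_const (1 - lam) + fps_const (- lam) * v) ^ s
      * (frobenius_euler_egf s x lam oo (- (fps_ln 1 oo v)))"
proof -
  define L where "L = fps_ln 1 oo v"
  \<comment> \<open>With \<open>u = 1 + v\<close>, \<open>B c\<close> is \<open>u^c\<close>;
    \<open>E\<close> is the factor of the \<open>PC\<close> series that is free of
    \<open>x\<close>.\<close>
  define B where "B = (\<lambda>c. fps_binomial c oo v)"
  define F where "F = frobenius_euler_egf s x lam oo (- L)"
  define E where "E = fps_exp (-1) * (Lif k oo L)"
  have v0: "fps_nth v 0 = 0" by (simp add: v_def)
  have L0: "fps_nth (- L) 0 = 0" by (simp add: L_def)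
  have exp_L: "fps_exp c oo (- L) = B (- c)" for c
    by (simp add: fps_exp_compose_uminus L_def B_def fps_compose_assoc v0
        flip: fps_exp_compose_fps_ln)
  have PC: "PC_egf k y a = E * B (- y)" for y
    by (simp add: PC_egf_def E_def B_def L_def v_def)
  have B1: "B (- 1) * (1 + v) = 1"
  proof -
    have "1 + v = B 1"
      by (simp add: B_def fps_binomial_1 fps_compose_add_distrib v_def)
    moreover have "B (- 1) * B 1 = 1"
      using fps_binomial_add_mult[of "- 1" "1 :: complex"]
      by (simp add: B_def flip: fps_compose_mult_distrib[OF v0])
    ultimately show ?thesis by simp
  qed
  have Bs: "B (- of_nat s) = B (- 1) ^ s"
    by (simp add: B_def fps_compose_power[OF v0] fps_binomial_power)
  have "F * (B (- 1) - fps_const lam) ^ s = fps_const ((1 - lam) ^ s) * B (- x)"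
    using arg_cong[OF frobenius_euler_egf_mult[OF assms(1), of s x], of "\<lambda>f. f oo (- L)"]
    by (simp add: fps_compose_mult_distrib[OF L0] fps_compose_sub_distrib exp_L F_def
        flip: fps_compose_power[OF L0])
  \<comment> \<open>This is \<open>1/u - lam = (1/u) (1 - lam u)\<close>. Its factor
    \<open>1/u\<close>, raised to the power \<open>s\<close>, supplies the
    \<open>B (- of_nat s)\<close> that turns \<open>E\<close> into the \<open>PC\<close> series at
    \<open>s\<close>.\<close>
  moreover have "B (- 1) - fps_const lam =
      B (- 1) * (fps_const (1 - lam) + fps_const (- lam) * v)"
  proof -
    have "B (- 1) * (fps_const (1 - lam) + fps_const (- lam) * v) =
        B (- 1) - fps_const lam * (B (- 1) * (1 + v))"
      by (simp add: algebra_simps flip: fps_const_sub fps_const_neg)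
    then show ?thesis by (simp add: B1)
  qed
  ultimately show ?thesis
    unfolding PC F_def[unfolded L_def, symmetric] Bs
    by (simp add: power_mult_distrib mult_ac)
qed

text \<open>In the binomial expansion, \<open>fps_X ^ i\<close> shifts the index to
  \<open>l - i\<close>, and \<open>fact l / fact (l - i)\<close> is the falling factorial. For
  \<open>i > l\<close> the subtraction truncates to 0, but the falling factorial vanishes.\<close>

lemma fps_nth_mult_linear_power:
  fixes b c :: "'a::field_char_0"
  shows "fact l * fps_nth (f * (fps_const b + fps_const c * fps_X) ^ s) l =
    (\<Sum>i=0..s. of_nat (s choose i) * falling_factorial (of_nat l) i * b ^ (s - i) * c ^ i
       * (fact (l - i) * fps_nth f (l - i)))"
proof -
  have "(fps_const b + fps_const c * fps_X) ^ s =
      (\<Sum>i=0..s. fps_const (of_nat (s choose i) * b ^ (s - i) * c ^ i) * fps_X ^ i)"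
    by (subst add.commute) (simp add: binomial_ring atLeast0AtMost power_mult_distrib mult_ac
        fps_of_nat flip: fps_const_mult fps_const_power)
  then have "f * (fps_const b + fps_const c * fps_X) ^ s =
      (\<Sum>i=0..s. fps_const (of_nat (s choose i) * b ^ (s - i) * c ^ i) * (fps_X ^ i * f))"
    by (simp add: sum_distrib_left mult_ac)
  then show ?thesis
    by (auto simp: fps_sum_nth fps_X_power_mult_nth falling_factorial_of_nat sum_distrib_left
        intro!: sum.cong)
qed

theorem theorem9:
  fixes n s :: nat and k :: int and lam a x :: complex
  assumes "lam \<noteq> 1" and "a \<noteq> 0"
  shows "PC n k x a =
    1 / (1 - lam) ^ s *
      (\<Sum>m = 0..n.
        ((-1) ^ m *
          (\<Sum>l = 0..n - m. \<Sum>i = 0..s.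
            of_nat (n choose l) * of_nat (s choose i) * falling_factorial (of_nat l) i
              / a ^ (n - l + i)
              * (1 - lam) ^ (s - i) * (- lam) ^ i
              * of_int (stirling1 (n - l) m) * PC (l - i) k (of_nat s) a))
        * frobenius_euler m s x lam)"
proof -
  define v where "v = fps_const (1 / a) * fps_X"
  define A where "A = PC_egf k (of_nat s) a * (fps_const (1 - lam) + fps_const (- lam) * v) ^ s"
  define L where "L = fps_ln 1 oo v"
  define T where "T = (\<lambda>m l. \<Sum>i = 0..s.
            of_nat (n choose l) * of_nat (s choose i) * falling_factorial (of_nat l) i
              / a ^ (n - l + i)
              * (1 - lam) ^ (s - i) * (- lam) ^ i
              * of_int (stirling1 (n - l) m) * PC (l - i) k (of_nat s) a)"
  have v0: "fps_nth v 0 = 0" by (simp add: v_def)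
  have A_nth: "fact l * fps_nth A l =
      (\<Sum>i=0..s. of_nat (s choose i) * falling_factorial (of_nat l) i * (1 - lam) ^ (s - i)
         * (- lam / a) ^ i * PC (l - i) k (of_nat s) a)" for l
  proof -
    have "A = PC_egf k (of_nat s) a * (fps_const (1 - lam) + fps_const (- lam / a) * fps_X) ^ s"
      by (simp add: A_def v_def flip: mult.assoc)
    then show ?thesis
      by (simp only: fps_nth_mult_linear_power PC_def)
  qed
  have L_nth: "fps_nth ((- L) ^ m) j = (- 1) ^ m * fact m / fact j * of_int (stirling1 j m) / a ^ j"
    for m j
  proof -
    have "(- L) ^ m = fps_const ((- 1) ^ m) * ((fps_ln 1 ^ m) oo v)"
      by (simp only: fps_uminus_power L_def fps_compose_power[OF v0])
    then show ?thesis
      by (simp add: v_def fps_ln_power_nth power_divide mult.assoc mult.commute[of "a ^ j"])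
  qed
  \<comment> \<open>The power \<open>a ^ (n - l)\<close> from \<open>L\<close> and
    \<open>a ^ i\<close> from the linear factor in \<open>A\<close> combine to the
    \<open>a ^ (n - l + i)\<close> of the claim.\<close>
  have summand: "fact n * (fps_nth A l * fps_nth ((- L) ^ m) (n - l)) = (- 1) ^ m * fact m * T m l"
    if "l \<le> n" for l m
  proof -
    have "fact n * (fps_nth A l * fps_nth ((- L) ^ m) (n - l)) =
        (- 1) ^ m * fact m * (of_nat (n choose l) * of_int (stirling1 (n - l) m) / a ^ (n - l)
          * (fact l * fps_nth A l))"
      using that by (simp add: L_nth binomial_fact)
    also have "\<dots> = (- 1) ^ m * fact m * T m l"
      unfolding A_nth T_def
      by (simp add: sum_distrib_left power_add power_divide mult_ac del: divide_minus_left minus_divide_left)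
    finally show ?thesis .
  qed
  have coeff: "fact n * fps_nth (A * (- L) ^ m) n = (- 1) ^ m * fact m * (\<Sum>l=0..n - m. T m l)" for m
  proof -
    have "fact n * fps_nth (A * (- L) ^ m) n = (\<Sum>l=0..n. (- 1) ^ m * fact m * T m l)"
      by (simp add: fps_mult_nth sum_distrib_left summand)
    also have "\<dots> = (- 1) ^ m * fact m * (\<Sum>l=0..n. T m l)"
      by (simp add: sum_distrib_left)
    also have "(\<Sum>l=0..n. T m l) = (\<Sum>l=0..n - m. T m l)"
      \<comment> \<open>For \<open>l > n - m\<close> one has \<open>n - l < m\<close>, so the
        Stirling number is 0.\<close>
      by (rule sum.mono_neutral_right) (auto simp: T_def stirling1_eq_0)
    finally show ?thesis .
  qed
  have "(1 - lam) ^ s * PC n k x a = fact n * fps_nth (fps_const ((1 - lam) ^ s) * PC_egf k x a) n"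
    by (simp add: PC_def)
  also have "\<dots> = fact n * fps_nth (A * (frobenius_euler_egf s x lam oo (- L))) n"
    by (simp only: PC_egf_conv_frobenius_euler_egf[OF assms(1)] A_def L_def v_def)
  also have "\<dots> = (\<Sum>m=0..n. fps_nth (frobenius_euler_egf s x lam) m
      * (fact n * fps_nth (A * (- L) ^ m) n))"
    by (simp add: fps_mult_compose_nth L_def sum_distrib_left mult_ac)
  also have "\<dots> = (\<Sum>m=0..n. ((- 1) ^ m * (\<Sum>l=0..n - m. T m l)) * frobenius_euler m s x lam)"
    unfolding coeff frobenius_euler_def by (simp add: mult_ac)
  finally show ?thesis
    using assms(1) unfolding T_def by (simp add: field_simps)
qed

end
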